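(* Let $\{\hat{\mathbf{E}}_l\}_{l\in\bar l}$, $\bar l=\{l_1,\dots,l_L\}$, be an ensemble of estimators of a quantity $E$, based on $T$ samples of dimension $d$. Assume that the following two conditions hold: (C.1) the bias is given by $$\mathbb{B}(\hat{\mathbf{E}}_l)=\sum_{i\in\mathcal I}c_i\,\psi_i(l)\,T^{-i/2d}+O(1/\sqrt T),$$ where the $c_i$ are constants that depend on the underlying density, $\mathcal I=\{i_1,\dots,i_I\}$ is a finite index set with cardinality $I<L$, $\min(\mathcal I)=i_0>0$ and $\max(\mathcal I)=i_d\le d$, and the $\psi_i(l)$ are basis functions that depend only on the estimator parameter $l$; (C.2) the variance is given by $$\mathbb{V}(\hat{\mathbf{E}}_l)=c_v\left(\frac1T\right)+o\left(\frac1T\right),$$ with $c_v$ a constant. Then there exists a weight vector $w_o$ such that $$\mathbb{E}\left[(\hat{\mathbf{E}}_{w_o}-E)^2\right]=O(1/T).$$ This weight vector can be found by solving the following convex optimization problem: $$\underset{w}{\text{minimize}}\ \|w\|_2\quad\text{subject to}\quad \sum_{l\in\bar l}w(l)=1,\qquad \gamma_w(i)=\sum_{l\in\bar l}w(l)\psi_i(l)=0,\ \ i\in\mathcal I,$$ where the $\psi_i(l)$ are the basis functions of condition (C.1).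
   Context: $\bar l=\{l_1,\dots,l_L\}$ is a set of $L$ parameter values. $T$ is the sample size and $d$ the dimension of the samples, which are drawn from an underlying probability density. For weights $w=\{w(l_1),\dots,w(l_L)\}$ satisfying $\sum_{l\in\bar l}w(l)=1$, the weighted ensemble estimator is $\hat{\mathbf{E}}_w=\sum_{l\in\bar l}w(l)\hat{\mathbf{E}}_l$. $\mathbb{E}$ denotes expectation, $\mathbb{V}$ denotes variance, and $\mathbb{B}$ denotes the bias of an estimator, i.e. its expectation minus the estimated quantity.
   Formalization: Added assumption: the constant function 1 on the parameter values is not a linear combination of the basis functions ψ_i. Without it the constraints are contradictory and the claim can fail (e.g. d=2, I={1}, ψ_1=1, E_l=E+T^{-1/4}). *)

theory Defs
  imports "HOL-Probability.Probability" "HOL-Library.Landau_Symbols"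
begin

text \<open>
  An estimator is a family, indexed by the sample size, of functions of the sample. A sample of
  size \<open>T\<close> is an element of the product space over the index set \<open>{..<T}\<close>, so the estimator
  cannot depend on any observation after the first \<open>T\<close>.
\<close>

definition estimate ::
    "(nat \<Rightarrow> 'w \<Rightarrow> 'a) \<Rightarrow> (nat \<Rightarrow> (nat \<Rightarrow> 'a) \<Rightarrow> real) \<Rightarrow> nat \<Rightarrow> 'w \<Rightarrow> real" where
  "estimate X e T = (\<lambda>\<omega>. e T (\<lambda>i\<in>{..<T}. X i \<omega>))"

definition bias :: "'w measure \<Rightarrow> ('w \<Rightarrow> real) \<Rightarrow> real \<Rightarrow> real" where
  "bias M Y E = prob_space.expectation M Y - E"

definition mean_squared_error :: "'w measure \<Rightarrow> ('w \<Rightarrow> real) \<Rightarrow> real \<Rightarrow> real" where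
  "mean_squared_error M Y E = prob_space.expectation M (\<lambda>\<omega>. (Y \<omega> - E)\<^sup>2)"

text \<open>
  The parameter values are enumerated by a finite type, as \<open>l\<close>, so that a weight vector is an
  element of Euclidean space: component \<open>k\<close> of \<open>w\<close> is the weight of the parameter \<open>l k\<close>.
\<close>

definition weighted_ensemble ::
    "('k::finite \<Rightarrow> 'p) \<Rightarrow> ('p \<Rightarrow> nat \<Rightarrow> (nat \<Rightarrow> 'a) \<Rightarrow> real) \<Rightarrow> real ^ 'k \<Rightarrow>
      nat \<Rightarrow> (nat \<Rightarrow> 'a) \<Rightarrow> real" where
  "weighted_ensemble l est w T x = (\<Sum>k\<in>UNIV. w $ k * est (l k) T x)"

definition basis_moment ::
    "('k::finite \<Rightarrow> 'p) \<Rightarrow> (real \<Rightarrow> 'p \<Rightarrow> real) \<Rightarrow> real ^ 'k \<Rightarrow> real \<Rightarrow> real" where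
  "basis_moment l \<psi> w i = (\<Sum>k\<in>UNIV. w $ k * \<psi> i (l k))"

definition feasible_weights ::
    "('k::finite \<Rightarrow> 'p) \<Rightarrow> (real \<Rightarrow> 'p \<Rightarrow> real) \<Rightarrow> real set \<Rightarrow> (real ^ 'k) set" where
  "feasible_weights l \<psi> I =
     {w. (\<Sum>k\<in>UNIV. w $ k) = 1 \<and> (\<forall>i\<in>I. basis_moment l \<psi> w i = 0)}"

text \<open>The norm on \<open>real ^ 'k\<close> is the Euclidean one.\<close>

definition optimal_weights ::
    "('k::finite \<Rightarrow> 'p) \<Rightarrow> (real \<Rightarrow> 'p \<Rightarrow> real) \<Rightarrow> real set \<Rightarrow> real ^ 'k \<Rightarrow> bool" where
  "optimal_weights l \<psi> I w \<longleftrightarrow> is_arg_min norm (\<lambda>v. v \<in> feasible_weights l \<psi> I) w"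

text \<open>
  The equality constraints are consistent exactly when the constant function 1, restricted to the
  parameter values, is not a linear combination of the basis functions. Having fewer basis
  functions than parameter values does not ensure this: a single constant, nonzero basis function
  makes the constraints contradictory. The condition holds in particular whenever the constant
  function and the basis functions are linearly independent on the parameter values.
\<close>

definition constant_independent ::
    "('k::finite \<Rightarrow> 'p) \<Rightarrow> (real \<Rightarrow> 'p \<Rightarrow> real) \<Rightarrow> real set \<Rightarrow> bool" where
  "constant_independent l \<psi> I \<longleftrightarrow>
     ((\<chi> k. 1) :: real ^ 'k) \<notin> span ((\<lambda>i. \<chi> k. \<psi> i (l k)) ` I)"

end

theory Submission
  imports Defs
begin

text \<open>
  The mean squared error is the variance plus the squared bias, and weights can make each summand
  \<open>O(1/T)\<close>. For any fixed weights the ensemble variance is at most \<open>\<parallel>w\<parallel>\<^sup>2\<close> times the sum of the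
  individual variances (\<open>variance_weighted_sum_le\<close>), which is what makes \<open>\<parallel>w\<parallel>\<close> a sensible
  objective. The bias is linear in the estimator once the weights sum to one
  (\<open>bias_weighted_sum\<close>), and the term of exponent \<open>-i/(2d)\<close> in the ensemble bias is
  proportional to \<open>\<gamma>\<^sub>w(i)\<close>. The constraints therefore remove every slowly decaying term, and
  a remainder \<open>O(1/sqrt T)\<close> is left, whose square is \<open>O(1/T)\<close>. So every feasible weight
  vector, and not only the shortest one, attains the rate (\<open>feasible_mean_squared_error_bigo\<close>).

  It remains to see that the optimisation problem has a solution. The feasible weights form an
  intersection of hyperplanes, hence a closed convex set; it is nonempty because the component of
  the all-ones vector orthogonal to the span of the basis vectors is nonzero and can be rescaled
  to have entries summing to one (\<open>feasible_weights_nonempty\<close>). A nonempty closed set contains a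
  point closest to the origin.
\<close>

section \<open>Mean squared error of a weighted sum\<close>

lemma (in prob_space) mean_squared_error_decomposition:
  assumes "random_variable borel Y" and "integrable M (\<lambda>\<omega>. (Y \<omega>)\<^sup>2)"
  shows "mean_squared_error M Y E = variance Y + (bias M Y E)\<^sup>2"
proof -
  have int: "integrable M Y"
    using assms by (rule square_integrable_imp_integrable)
  have "mean_squared_error M Y E = expectation (\<lambda>\<omega>. (Y \<omega>)\<^sup>2 - 2 * E * Y \<omega> + E\<^sup>2)"
    by (simp add: mean_squared_error_def power2_diff algebra_simps)
  also have "\<dots> = expectation (\<lambda>\<omega>. (Y \<omega>)\<^sup>2) - 2 * E * expectation Y + E\<^sup>2"
    using int assms(2) by (simp add: prob_space)
  also have "\<dots> = variance Y + (bias M Y E)\<^sup>2"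
    using variance_eq[OF int assms(2)] by (simp add: bias_def power2_diff algebra_simps)
  finally show ?thesis .
qed

lemma power2_weighted_sum_le_norm:
  fixes w :: "real ^ 'k::finite"
  shows "(\<Sum>k\<in>UNIV. w $ k * z k)\<^sup>2 \<le> (norm w)\<^sup>2 * (\<Sum>k\<in>UNIV. (z k)\<^sup>2)"
proof -
  have "(w \<bullet> (\<chi> k. z k))\<^sup>2 \<le> (w \<bullet> w) * ((\<chi> k. z k) \<bullet> (\<chi> k. z k))"
    by (rule Cauchy_Schwarz_ineq)
  then show ?thesis
    by (simp add: power2_norm_eq_inner) (simp add: inner_vec_def power2_eq_square)
qed

lemma integrable_power2_weighted_sum:
  fixes w :: "real ^ 'k::finite" and Y :: "'k \<Rightarrow> 'w \<Rightarrow> real"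
  assumes Y: "\<And>k. Y k \<in> borel_measurable M" "\<And>k. integrable M (\<lambda>\<omega>. (Y k \<omega>)\<^sup>2)"
  shows "integrable M (\<lambda>\<omega>. (\<Sum>k\<in>UNIV. w $ k * Y k \<omega>)\<^sup>2)"
proof (rule Bochner_Integration.integrable_bound)
  show "integrable M (\<lambda>\<omega>. (norm w)\<^sup>2 * (\<Sum>k\<in>UNIV. (Y k \<omega>)\<^sup>2))"
    using Y(2) by simp
  show "(\<lambda>\<omega>. (\<Sum>k\<in>UNIV. w $ k * Y k \<omega>)\<^sup>2) \<in> borel_measurable M"
    using Y(1) by measurable
  show "AE \<omega> in M. norm ((\<Sum>k\<in>UNIV. w $ k * Y k \<omega>)\<^sup>2)
          \<le> norm ((norm w)\<^sup>2 * (\<Sum>k\<in>UNIV. (Y k \<omega>)\<^sup>2))"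
    using power2_weighted_sum_le_norm[of w] by (auto simp: sum_nonneg)
qed

text \<open>
  The estimators of an ensemble see the same sample and are thus dependent, so variances do not
  add up. The bound comes instead from Cauchy--Schwarz, applied at each point to the centred
  variables and then integrated.
\<close>

lemma (in prob_space) variance_weighted_sum_le:
  fixes w :: "real ^ 'k::finite" and Y :: "'k \<Rightarrow> 'a \<Rightarrow> real"
  assumes Y: "\<And>k. random_variable borel (Y k)" "\<And>k. integrable M (\<lambda>\<omega>. (Y k \<omega>)\<^sup>2)"
  shows "variance (\<lambda>\<omega>. \<Sum>k\<in>UNIV. w $ k * Y k \<omega>) \<le> (norm w)\<^sup>2 * (\<Sum>k\<in>UNIV. variance (Y k))"
proof -
  define Z where "Z k \<omega> = Y k \<omega> - expectation (Y k)" for k \<omega>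
  have int: "integrable M (Y k)" for k
    using Y by (rule square_integrable_imp_integrable)
  have Z: "random_variable borel (Z k)" "integrable M (\<lambda>\<omega>. (Z k \<omega>)\<^sup>2)" for k
    using Y[of k] int[of k] unfolding Z_def[abs_def] by (simp_all add: power2_diff)
  have "variance (\<lambda>\<omega>. \<Sum>k\<in>UNIV. w $ k * Y k \<omega>) = expectation (\<lambda>\<omega>. (\<Sum>k\<in>UNIV. w $ k * Z k \<omega>)\<^sup>2)"
    using int by (simp add: Z_def right_diff_distrib sum_subtractf)
  also have "\<dots> \<le> expectation (\<lambda>\<omega>. (norm w)\<^sup>2 * (\<Sum>k\<in>UNIV. (Z k \<omega>)\<^sup>2))"
    using Z(2) by (intro integral_mono integrable_power2_weighted_sum[OF Z] power2_weighted_sum_le_norm) simp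
  also have "\<dots> = (norm w)\<^sup>2 * (\<Sum>k\<in>UNIV. variance (Y k))"
    using Z(2) by (simp add: Z_def)
  finally show ?thesis .
qed

text \<open>
  The normalisation of the weights makes \<open>E\<close> the weighted sum of copies of itself, so that
  the bias can be taken term by term.
\<close>

lemma (in prob_space) bias_weighted_sum:
  fixes w :: "real ^ 'k::finite" and Y :: "'k \<Rightarrow> 'a \<Rightarrow> real"
  assumes "\<And>k. integrable M (Y k)" and "(\<Sum>k\<in>UNIV. w $ k) = 1"
  shows "bias M (\<lambda>\<omega>. \<Sum>k\<in>UNIV. w $ k * Y k \<omega>) E = (\<Sum>k\<in>UNIV. w $ k * bias M (Y k) E)"
  using assms by (simp add: bias_def right_diff_distrib sum_subtractf flip: sum_distrib_right)

section \<open>The weight constraints\<close>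

lemma basis_moment_inner: "basis_moment l \<psi> w i = w \<bullet> (\<chi> k. \<psi> i (l k))"
  by (simp add: basis_moment_def inner_vec_def)

lemma feasible_weights_inner:
  "feasible_weights l \<psi> I =
    {w. w \<bullet> (\<chi> k. 1) = 1} \<inter> (\<Inter>i\<in>I. {w. w \<bullet> (\<chi> k. \<psi> i (l k)) = 0})"
  by (auto simp: feasible_weights_def basis_moment_inner inner_vec_def)

lemma closed_feasible_weights: "closed (feasible_weights l \<psi> I)"
  unfolding feasible_weights_inner
  by (intro closed_Int closed_INT ballI closed_Collect_eq continuous_intros)

lemma convex_feasible_weights: "convex (feasible_weights l \<psi> I)"
  unfolding feasible_weights_inner inner_commute[where y="\<chi> k. _ k"]
  by (intro convex_Int convex_INT convex_hyperplane)

text \<open>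
  Split the all-ones vector as \<open>y + z\<close> with \<open>y\<close> in the span of the basis vectors and
  \<open>z\<close> orthogonal to it. Then \<open>z\<close> has vanishing moments, and the sum of its entries is
  \<open>z \<bullet> (y + z) = z \<bullet> z\<close>, which is nonzero because the all-ones vector lies outside the span.
\<close>

lemma feasible_weights_nonempty:
  fixes l :: "'k::finite \<Rightarrow> 'p"
  assumes "constant_independent l \<psi> I"
  shows "feasible_weights l \<psi> I \<noteq> {}"
proof -
  let ?one = "(\<chi> k. 1) :: real ^ 'k" and ?S = "(\<lambda>i. \<chi> k. \<psi> i (l k)) ` I"
  obtain y z where y: "y \<in> span ?S" and z: "\<And>v. v \<in> span ?S \<Longrightarrow> orthogonal z v"
    and one: "?one = y + z"
    using orthogonal_subspace_decomp_exists[of ?S ?one] by metis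
  have "z \<noteq> 0"
    using assms y one by (auto simp: constant_independent_def)
  moreover have "z \<bullet> ?one = z \<bullet> z"
    using z[OF y] by (simp add: one inner_add_right orthogonal_def)
  moreover have "z \<bullet> (\<chi> k. \<psi> i (l k)) = 0" if "i \<in> I" for i
    using z[of "\<chi> k. \<psi> i (l k)"] that by (auto simp: orthogonal_def intro: span_base)
  ultimately have "z /\<^sub>R (z \<bullet> z) \<in> feasible_weights l \<psi> I"
    by (simp add: feasible_weights_inner)
  then show ?thesis by blast
qed

lemma optimal_weights_exist:
  assumes "feasible_weights l \<psi> I \<noteq> {}"
  shows "\<exists>w. optimal_weights l \<psi> I w"
proof -
  obtain w where "w \<in> feasible_weights l \<psi> I"
    and "\<And>v. v \<in> feasible_weights l \<psi> I \<Longrightarrow> dist 0 w \<le> dist 0 v"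
    using distance_attains_inf[OF closed_feasible_weights assms] by metis
  then have "optimal_weights l \<psi> I w"
    by (simp add: optimal_weights_def is_arg_min_linorder)
  then show ?thesis ..
qed

lemma optimal_weights_feasible: "optimal_weights l \<psi> I w \<Longrightarrow> w \<in> feasible_weights l \<psi> I"
  by (simp add: optimal_weights_def is_arg_min_def)

section \<open>Rate of the ensemble estimator\<close>

lemma estimate_measurable:
  assumes "\<And>i. X i \<in> borel_measurable M"
    and "e T \<in> borel_measurable (PiM {..<T} (\<lambda>_. borel))"
  shows "estimate X e T \<in> borel_measurable M"
  unfolding estimate_def
  using measurable_restrict[of "{..<T}" X M "\<lambda>_. borel"] assms by (auto intro: measurable_compose)

lemma estimate_weighted_ensemble:
  "estimate X (weighted_ensemble l est w) T = (\<lambda>\<omega>. \<Sum>k\<in>UNIV. w $ k * estimate X (est (l k)) T \<omega>)"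
  by (simp add: estimate_def weighted_ensemble_def)

text \<open>
  Exchanging the two sums turns the weighted bias expansion into a combination of the moments
  \<open>\<gamma>\<^sub>w(i)\<close>, so it vanishes whatever the density-dependent constants \<open>c i\<close> and the
  rates \<open>t i\<close> are. This is why the weights can be computed without knowing the density.
\<close>

lemma sum_basis_expansion_cancels:
  assumes "w \<in> feasible_weights l \<psi> I"
  shows "(\<Sum>k\<in>UNIV. w $ k * (\<Sum>i\<in>I. c i * \<psi> i (l k) * t i)) = 0"
proof -
  have "(\<Sum>k\<in>UNIV. w $ k * (\<Sum>i\<in>I. c i * \<psi> i (l k) * t i)) = (\<Sum>i\<in>I. c i * t i * basis_moment l \<psi> w i)"
    unfolding basis_moment_def sum_distrib_left by (subst sum.swap) (simp add: ac_simps)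
  then show ?thesis
    using assms by (simp add: feasible_weights_def)
qed

lemma variance_bigo:
  assumes "(\<lambda>T. v T - c * (1 / real T)) \<in> o(\<lambda>T. 1 / real T)"
  shows "v \<in> O(\<lambda>T. 1 / real T)"
proof -
  have "(\<lambda>T. (v T - c * (1 / real T)) + c * (1 / real T)) \<in> O(\<lambda>T. 1 / real T)"
    by (rule sum_in_bigo(1)[OF landau_o.small_imp_big[OF assms]]) (auto intro: bigoI[of _ "\<bar>c\<bar>"])
  then show ?thesis by simp
qed

text \<open>
  Every term \<open>t i T\<close> cancels for each sample size separately, so only the remainder of the bias
  expansion decides the rate.
\<close>

lemma (in prob_space) feasible_mean_squared_error_bigo:
  fixes X :: "nat \<Rightarrow> 'a \<Rightarrow> real ^ 'd" and l :: "'k::finite \<Rightarrow> 'p"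
  assumes X: "\<And>i. random_variable borel (X i)"
    and est: "\<And>k T. est (l k) T \<in> borel_measurable (PiM {..<T} (\<lambda>_. borel))"
    and square: "\<And>k T. 0 < T \<Longrightarrow> integrable M (\<lambda>\<omega>. (estimate X (est (l k)) T \<omega>)\<^sup>2)"
    and bias: "\<And>k. (\<lambda>T. bias M (estimate X (est (l k)) T) E - (\<Sum>i\<in>I. c i * \<psi> i (l k) * t i T))
                 \<in> O(\<lambda>T. 1 / sqrt (real T))"
    and var: "\<And>k. (\<lambda>T. variance (estimate X (est (l k)) T)) \<in> O(\<lambda>T. 1 / real T)"
    and w: "w \<in> feasible_weights l \<psi> I"
  shows "(\<lambda>T. mean_squared_error M (estimate X (weighted_ensemble l est w) T) E) \<in> O(\<lambda>T. 1 / real T)"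
proof -
  define Y where "Y k T = estimate X (est (l k)) T" for k T
  \<comment> \<open>the part of each bias that the moment constraints leave over\<close>
  define R where "R k T = bias M (Y k T) E - (\<Sum>i\<in>I. c i * \<psi> i (l k) * t i T)" for k T
  define B where "B T = (norm w)\<^sup>2 * (\<Sum>k\<in>UNIV. variance (Y k T)) + (\<Sum>k\<in>UNIV. w $ k * R k T)\<^sup>2" for T
  have rv: "random_variable borel (Y k T)" for k T
    unfolding Y_def by (intro estimate_measurable X est)
  have le: "mean_squared_error M (estimate X (weighted_ensemble l est w) T) E \<le> B T" if "0 < T" for T
  proof -
    let ?Y = "\<lambda>\<omega>. \<Sum>k\<in>UNIV. w $ k * Y k T \<omega>"
    have sq: "integrable M (\<lambda>\<omega>. (Y k T \<omega>)\<^sup>2)" for k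
      using square that by (simp add: Y_def)
    have "bias M ?Y E = (\<Sum>k\<in>UNIV. w $ k * bias M (Y k T) E)"
      using w by (intro bias_weighted_sum square_integrable_imp_integrable[OF rv sq])
        (simp add: feasible_weights_def)
    also have "\<dots> = (\<Sum>k\<in>UNIV. w $ k * R k T)"
      using sum_basis_expansion_cancels[OF w, of c "\<lambda>i. t i T"]
      by (simp add: R_def right_diff_distrib sum_subtractf)
    finally have "mean_squared_error M ?Y E = variance ?Y + (\<Sum>k\<in>UNIV. w $ k * R k T)\<^sup>2"
      using mean_squared_error_decomposition[of ?Y E] integrable_power2_weighted_sum[OF rv sq, of w] rv
      by simp
    then show ?thesis
      using variance_weighted_sum_le[OF rv sq, of w]
      by (simp add: B_def estimate_weighted_ensemble flip: Y_def)
  qed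
  have R: "(\<lambda>T. \<Sum>k\<in>UNIV. w $ k * R k T) \<in> O(\<lambda>T. 1 / sqrt (real T))"
    using bias by (intro big_sum_in_bigo) (simp add: R_def Y_def)
  have "(\<lambda>T. (\<Sum>k\<in>UNIV. w $ k * R k T)\<^sup>2) \<in> O(\<lambda>T. 1 / real T)"
    using landau_o.big_power[OF R, of 2] by (simp add: power_divide)
  moreover have "(\<lambda>T. (norm w)\<^sup>2 * (\<Sum>k\<in>UNIV. variance (Y k T))) \<in> O(\<lambda>T. 1 / real T)"
    using big_sum_in_bigo[of UNIV "\<lambda>k T. variance (Y k T)"] var by (simp add: Y_def)
  ultimately have "B \<in> O(\<lambda>T. 1 / real T)"
    unfolding B_def by (rule sum_in_bigo(1)[rotated])
  moreover have "(\<lambda>T. mean_squared_error M (estimate X (weighted_ensemble l est w) T) E) \<in> O(B)"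
    using le by (intro landau_o.big_mono eventually_mono[OF eventually_gt_at_top[of 0]])
      (smt (verit) real_norm_def mean_squared_error_def integral_nonneg_AE AE_I2 zero_le_power2)
  ultimately show ?thesis
    by (rule landau_o.big_trans[rotated])
qed

theorem theorem1:
  fixes M :: "'w measure"
    and X :: "nat \<Rightarrow> 'w \<Rightarrow> real ^ 'd"
    and f :: "real ^ 'd \<Rightarrow> ennreal"
    and l :: "'k::finite \<Rightarrow> 'p"
    and est :: "'p \<Rightarrow> nat \<Rightarrow> (nat \<Rightarrow> real ^ 'd) \<Rightarrow> real"
    and E c\<^sub>v :: real
    and I :: "real set"
    and c :: "real \<Rightarrow> real"
    and \<psi> :: "real \<Rightarrow> 'p \<Rightarrow> real"
  assumes prob: "prob_space M"
    and samples: "\<And>i. distributed M lborel (X i) f"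
    and params: "inj l"
    and est_measurable: "\<And>k T. est (l k) T \<in> borel_measurable (PiM {..<T} (\<lambda>_. borel))"
    and finite_variance:
      "\<And>k T. 0 < T \<Longrightarrow> integrable M (\<lambda>\<omega>. (estimate X (est (l k)) T \<omega>)\<^sup>2)"
    and index_set: "finite I" "I \<noteq> {}" "card I < CARD('k)" "0 < Min I" "Max I \<le> real CARD('d)"
    and basis: "constant_independent l \<psi> I"
    and C1: "\<And>k. (\<lambda>T. bias M (estimate X (est (l k)) T) E
                     - (\<Sum>i\<in>I. c i * \<psi> i (l k) * real T powr (- i / (2 * real CARD('d)))))
                   \<in> O(\<lambda>T. 1 / sqrt (real T))"
    and C2: "\<And>k. (\<lambda>T. prob_space.variance M (estimate X (est (l k)) T) - c\<^sub>v * (1 / real T))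
                   \<in> o(\<lambda>T. 1 / real T)"
  shows "(\<exists>w\<^sub>o :: real ^ 'k. (\<Sum>k\<in>UNIV. w\<^sub>o $ k) = 1 \<and>
            (\<lambda>T. mean_squared_error M (estimate X (weighted_ensemble l est w\<^sub>o) T) E)
              \<in> O(\<lambda>T. 1 / real T))
       \<and> convex_on (feasible_weights l \<psi> I) norm
       \<and> (\<exists>w. optimal_weights l \<psi> I w)
       \<and> (\<forall>w. optimal_weights l \<psi> I w \<longrightarrow>
            (\<lambda>T. mean_squared_error M (estimate X (weighted_ensemble l est w) T) E)
              \<in> O(\<lambda>T. 1 / real T))"
proof -
  interpret prob_space M by (rule prob)
  have rate: "(\<lambda>T. mean_squared_error M (estimate X (weighted_ensemble l est w) T) E) \<in> O(\<lambda>T. 1 / real T)"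
    if "w \<in> feasible_weights l \<psi> I" for w
    using distributed_measurable[OF samples] variance_bigo[OF C2]
    by (intro feasible_mean_squared_error_bigo[where c=c and I=I and \<psi>=\<psi>, OF _ est_measurable finite_variance C1 _ that])
      auto
  obtain w where opt: "optimal_weights l \<psi> I w"
    using optimal_weights_exist feasible_weights_nonempty[OF basis] by metis
  have "(\<Sum>k\<in>UNIV. w $ k) = 1"
    using optimal_weights_feasible[OF opt] by (simp add: feasible_weights_def)
  moreover have "convex_on (feasible_weights l \<psi> I) norm"
    using convex_on_dist[OF convex_feasible_weights, where a = 0] by simp
  ultimately show ?thesis
    using opt rate optimal_weights_feasible by blast
qed

end
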